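(* Let $N\ge 2$ and $K\ge 1$ be integers, let $\alpha_k,\beta_k,\delta_k>0$ for $k=1,\dots,K$, and let $x(t)$ be the inhomogeneous symmetric simple exclusion process with open boundaries on $G=\{0,1,\dots,K\}^N$ with these rates. Then the stationary distribution of the site state is the same for every site, and the steady site-state probabilities are $$P_i(0)=\frac{1}{1+\sum_{k=1}^K\frac{\alpha_k}{\beta_k}},\quad i=1,\dots,N,$$ $$P_i(k)=\frac{\alpha_k}{\beta_k}\left(1+\sum_{l=1}^K\frac{\alpha_l}{\beta_l}\right)^{-1},\quad k=1,\dots,K,\ i=1,\dots,N.$$
   Context: The process: $x(t)=(x_1(t),\dots,x_N(t))$, $t\ge0$, is a continuous-time Markov chain with finite state space $G=\{0,1,\dots,K\}^N$. Sites are numbered $1,\dots,N$ from left to right; $x_i=0$ means that site $i$ is vacant, and $x_i=k\in\{1,\dots,K\}$ means that site $i$ is occupied by a particle of type $k$. The transitions and their rates are, for each $k=1,\dots,K$: (arrival) for $i=1$ and for $i=N$, if $x_i=0$, then $x_i$ changes to $k$ at rate $\alpha_k$ (a particle of type $k$ enters from outside); (departure) for $i=1$ and for $i=N$, if $x_i=k$, then $x_i$ changes to $0$ at rate $\beta_k$ (the particle leaves the system); (hop) for any two adjacent sites $i,j\in\{1,\dots,N\}$, $|i-j|=1$, if $x_i=k$ and $x_j=0$, then the particle in site $i$ moves to site $j$ (so $x_i$ becomes $0$ and $x_j$ becomes $k$) at rate $\delta_k$. No other transitions occur. Site-state probabilities: $P_i(a)$ denotes the steady (limiting as $t\to\infty$,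 equivalently stationary) probability that site $i$ is in state $a\in\{0,1,\dots,K\}$, i.e. the probability of $\{x_i=a\}$ under the stationary distribution of the chain. *)

theory Defs
  imports "HOL-Probability.Probability"
begin

section \<open>Continuous-time Markov chains on a finite state set\<close>

text \<open>A chain on a finite set \<open>S\<close> is specified by the rates \<open>q x y\<close> of the jumps
  from \<open>x\<close> to \<open>y \<noteq> x\<close>; the values \<open>q x x\<close> are irrelevant.\<close>

definition ctmc_gen :: "'s set \<Rightarrow> ('s \<Rightarrow> 's \<Rightarrow> real) \<Rightarrow> 's \<Rightarrow> 's \<Rightarrow> real" where
  "ctmc_gen S q x y = (if x = y then - (\<Sum>z\<in>S - {x}. q x z) else q x y)"

fun mat_pow :: "'s set \<Rightarrow> ('s \<Rightarrow> 's \<Rightarrow> real) \<Rightarrow> nat \<Rightarrow> 's \<Rightarrow> 's \<Rightarrow> real" where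
  "mat_pow S A 0 x y = (if x = y then 1 else 0)"
| "mat_pow S A (Suc n) x y = (\<Sum>z\<in>S. mat_pow S A n x z * A z y)"

text \<open>The transition probabilities are the entries of the matrix exponential of \<open>t\<close> times the
  generator. The series converges absolutely for all \<open>x, y \<in> S\<close> because \<open>S\<close> is finite.\<close>

definition ctmc_trans :: "'s set \<Rightarrow> ('s \<Rightarrow> 's \<Rightarrow> real) \<Rightarrow> real \<Rightarrow> 's \<Rightarrow> 's \<Rightarrow> real" where
  "ctmc_trans S q t x y = (\<Sum>n. t ^ n / fact n * mat_pow S (ctmc_gen S q) n x y)"

definition ctmc_stationary :: "'s set \<Rightarrow> ('s \<Rightarrow> 's \<Rightarrow> real) \<Rightarrow> 's pmf \<Rightarrow> bool" where
  "ctmc_stationary S q \<pi> \<longleftrightarrow>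
     set_pmf \<pi> \<subseteq> S \<and>
     (\<forall>t\<ge>0. \<forall>y\<in>S. (\<Sum>x\<in>S. pmf \<pi> x * ctmc_trans S q t x y) = pmf \<pi> y)"

text \<open>\<open>X\<close> is a Markov chain with jump rates \<open>q\<close> and arbitrary initial distribution. The Markov
  property is written in product form, which avoids conditioning on null events. No path
  regularity is required.\<close>

definition ctmc_process ::
  "'w measure \<Rightarrow> 's set \<Rightarrow> ('s \<Rightarrow> 's \<Rightarrow> real) \<Rightarrow> (real \<Rightarrow> 'w \<Rightarrow> 's) \<Rightarrow> bool" where
  "ctmc_process M S q X \<longleftrightarrow>
     prob_space M \<and>
     (\<forall>t\<ge>0. X t \<in> measurable M (count_space S)) \<and>
     (\<forall>(n::nat) (\<tau> :: nat \<Rightarrow> real) s.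
        0 \<le> \<tau> 0 \<longrightarrow> (\<forall>j\<le>n. \<tau> j < \<tau> (Suc j)) \<longrightarrow> (\<forall>j\<le>Suc n. s j \<in> S) \<longrightarrow>
        measure M {\<omega> \<in> space M. \<forall>j\<le>Suc n. X (\<tau> j) \<omega> = s j} =
        measure M {\<omega> \<in> space M. \<forall>j\<le>n. X (\<tau> j) \<omega> = s j} *
          ctmc_trans S q (\<tau> (Suc n) - \<tau> n) (s n) (s (Suc n)))"

section \<open>The inhomogeneous symmetric simple exclusion process with open boundaries\<close>

text \<open>Configurations are extensional functions on the sites \<open>1, \<dots>, N\<close>, so that equality of
  configurations is equality at all sites and the set of configurations is finite.\<close>

definition ssep_states :: "nat \<Rightarrow> nat \<Rightarrow> (nat \<Rightarrow> nat) set" where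
  "ssep_states N K = ({1..N} \<rightarrow>\<^sub>E {0..K})"

definition ssep_rate ::
  "nat \<Rightarrow> nat \<Rightarrow> (nat \<Rightarrow> real) \<Rightarrow> (nat \<Rightarrow> real) \<Rightarrow> (nat \<Rightarrow> real) \<Rightarrow>
   (nat \<Rightarrow> nat) \<Rightarrow> (nat \<Rightarrow> nat) \<Rightarrow> real" where
  "ssep_rate N K \<alpha> \<beta> \<delta> x y =
     (\<Sum>k=1..K.
        (\<Sum>i\<in>{1, N}. if x i = 0 \<and> y = x(i := k) then \<alpha> k else 0)
      + (\<Sum>i\<in>{1, N}. if x i = k \<and> y = x(i := 0) then \<beta> k else 0)
      + (\<Sum>i=1..N. \<Sum>j\<in>{j \<in> {1..N}. j = i + 1 \<or> i = j + 1}.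
           if x i = k \<and> x j = 0 \<and> y = x(i := 0, j := k) then \<delta> k else 0))"

end

theory Submission
  imports Defs "HOL-Computational_Algebra.Formal_Power_Series"
begin

text \<open>The product measure giving each site the weights \<open>1\<close> (vacant) and \<open>\<alpha> k / \<beta> k\<close> (type \<open>k\<close>)
  satisfies detailed balance: an arrival is balanced by the departure of the same particle, and
  the two directions of a hop have equal rates and equal weights. The chain is irreducible, since
  every configuration can be emptied. Writing the generator as \<open>c (J - I)\<close> with a stochastic matrix
  \<open>J\<close> gives \<open>exp (t c (J - I)) = e\<^sup>-\<^sup>c\<^sup>t \<Sum>\<^sub>n (c t)\<^sup>n / n! J\<^sup>n\<close>, so geometric convergence of \<open>J\<^sup>n\<close>
  (Doeblin) yields exponential convergence of the transition probabilities, and hence uniqueness.\<close>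

section \<open>Uniformization and convergence of finite chains\<close>

text \<open>Induction on the second exponent, because \<open>mat_pow\<close> multiplies on the
  right. In the base case the sum collapses to the index \<open>y\<close>, which must therefore lie
  in \<open>S\<close>.\<close>

lemma mat_pow_add:
  assumes "finite S" "y \<in> S"
  shows "mat_pow S A (m + n) x y = (\<Sum>z\<in>S. mat_pow S A m x z * mat_pow S A n z y)"
  using assms(2)
proof (induction n arbitrary: y)
  case 0
  have "(\<Sum>z\<in>S. mat_pow S A m x z * mat_pow S A 0 z y)
      = (\<Sum>z\<in>S. if z = y then mat_pow S A m x z else 0)"
    by (rule sum.cong) auto
  then show ?case using assms(1) 0 by (simp add: sum.delta)
next
  case (Suc n)
  have "mat_pow S A (m + Suc n) x y
      = (\<Sum>w\<in>S. (\<Sum>z\<in>S. mat_pow S A m x z * mat_pow S A n z w) * A w y)"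
    using Suc.IH by simp
  also have "\<dots> = (\<Sum>w\<in>S. \<Sum>z\<in>S. mat_pow S A m x z * (mat_pow S A n z w * A w y))"
    by (simp add: sum_distrib_right mult.assoc)
  also have "\<dots> = (\<Sum>z\<in>S. \<Sum>w\<in>S. mat_pow S A m x z * (mat_pow S A n z w * A w y))"
    by (rule sum.swap)
  finally show ?case by (simp add: sum_distrib_left)
qed

text \<open>Coefficient form of exp(tA) = exp(-ct) exp(ctB) for A = c(B - I). The product on the
  right solves the formal equation G' = GA, so its coefficients obey the recursion of the powers of
  A divided by factorials, from the same initial value. Formal power series keep convergence out of
  the argument.\<close>

lemma exp_mat_pow_fps:
  fixes c :: real and A B :: "'s \<Rightarrow> 's \<Rightarrow> real"
  assumes "finite S"
    and A: "\<And>x y. x \<in> S \<Longrightarrow> y \<in> S \<Longrightarrow> A x y = c * (B x y - (if x = y then 1 else 0))"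
    and "y \<in> S"
  shows "mat_pow S A n x y / fact n
    = fps_nth (fps_exp (- c) * Abs_fps (\<lambda>k. c ^ k / fact k * mat_pow S B k x y)) n"
  using assms(3)
proof (induction n arbitrary: y)
  case 0
  then show ?case by simp
next
  case (Suc n)
  define F where "F = (\<lambda>y. Abs_fps (\<lambda>k. c ^ k / fact k * mat_pow S B k x y))"
  define E where "E = fps_exp (- c)"
  have derivF: "fps_deriv (F y) = (\<Sum>z\<in>S. fps_const (c * B z y) * F z)"
  proof (rule fps_ext)
    fix k
    have "fps_nth (fps_deriv (F y)) k = real (Suc k) * (c ^ Suc k / fact (Suc k) * mat_pow S B (Suc k) x y)"
      by (simp add: F_def del: fact_Suc mat_pow.simps)
    also have "\<dots> = c ^ Suc k / fact k * mat_pow S B (Suc k) x y"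
      by (simp add: field_simps del: mat_pow.simps of_nat_Suc)
    also have "\<dots> = (\<Sum>z\<in>S. c * B z y * (c ^ k / fact k * mat_pow S B k x z))"
      by (simp add: sum_distrib_left mult_ac)
    finally show "fps_nth (fps_deriv (F y)) k = fps_nth (\<Sum>z\<in>S. fps_const (c * B z y) * F z) k"
      by (simp add: F_def fps_sum_nth)
  qed
  have "fps_deriv (E * F y) = E * (\<Sum>z\<in>S. fps_const (c * B z y) * F z) - fps_const c * E * F y"
    unfolding fps_deriv_mult derivF by (simp add: E_def flip: fps_const_neg)
  also have "\<dots> = (\<Sum>z\<in>S. fps_const (c * B z y) * (E * F z)) - fps_const c * (E * F y)"
    by (simp add: sum_distrib_left mult_ac)
  \<comment> \<open>The term from differentiating \<open>E\<close> is spread over all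
    \<open>z\<close> as a diagonal sum, so that it merges with the sum for \<open>B\<close> into the
    entries \<open>A z y\<close>.\<close>
  also have "fps_const c * (E * F y) = (\<Sum>z\<in>S. if z = y then fps_const c * (E * F z) else 0)"
    using assms(1) Suc.prems by (simp add: sum.delta)
  also have "(\<Sum>z\<in>S. fps_const (c * B z y) * (E * F z)) - \<dots>
      = (\<Sum>z\<in>S. fps_const (A z y) * (E * F z))"
    unfolding sum_subtractf[symmetric]
    by (rule sum.cong) (auto simp: A Suc.prems algebra_simps simp flip: fps_const_sub fps_const_mult)
  finally have deriv: "fps_deriv (E * F y) = (\<Sum>z\<in>S. fps_const (A z y) * (E * F z))" .
  have "real (Suc n) * fps_nth (E * F y) (Suc n) = fps_nth (fps_deriv (E * F y)) n"
    by (simp del: fps_deriv_mult)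
  also have "\<dots> = (\<Sum>z\<in>S. A z y * (mat_pow S A n x z / fact n))"
    unfolding deriv by (simp add: fps_sum_nth Suc.IH E_def F_def)
  also have "\<dots> = mat_pow S A (Suc n) x y / fact n"
    by (simp add: sum_divide_distrib mult_ac)
  finally have "fps_nth (E * F y) (Suc n) = mat_pow S A (Suc n) x y / fact (Suc n)"
    by (simp add: field_simps del: mat_pow.simps of_nat_Suc)
  then show ?case by (simp add: E_def F_def del: mat_pow.simps)
qed

section \<open>Irreducible finite chains and their jump matrix\<close>

text \<open>Invariance of \<pi> enters as the equation \<pi>Q = 0 for the generator Q, which can be
  checked directly on the rates. Invariance under the transition probabilities is derived from it in
  \<open>stationary\<close>.\<close>

locale irreducible_ctmc =
  fixes S :: "'s set" and q :: "'s \<Rightarrow> 's \<Rightarrow> real" and \<pi> :: "'s pmf"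
  assumes finite_states: "finite S"
    and rate_nonneg: "\<And>x y. x \<in> S \<Longrightarrow> y \<in> S \<Longrightarrow> 0 \<le> q x y"
    and irreducible: "\<And>x y. x \<in> S \<Longrightarrow> y \<in> S \<Longrightarrow>
      (x, y) \<in> {(x, y). x \<in> S \<and> y \<in> S \<and> 0 < q x y}\<^sup>*"
    and supp: "set_pmf \<pi> \<subseteq> S"
    and balance: "\<And>y. y \<in> S \<Longrightarrow> (\<Sum>x\<in>S. pmf \<pi> x * ctmc_gen S q x y) = 0"
begin

text \<open>A uniformization rate. It strictly exceeds every exit rate, which makes the diagonal of
  the jump matrix \<open>jump\<close> positive and hence the discrete skeleton aperiodic.\<close>

definition c :: real where
  "c = 1 + (\<Sum>x\<in>S. \<Sum>y\<in>S. q x y)"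

definition jump :: "'s \<Rightarrow> 's \<Rightarrow> real" where
  "jump x y = (if x = y then 1 else 0) + ctmc_gen S q x y / c"

lemma c_pos: "0 < c"
  unfolding c_def using rate_nonneg by (simp add: add_pos_nonneg sum_nonneg)

lemma exit_rate_less:
  assumes "x \<in> S" shows "(\<Sum>y\<in>S - {x}. q x y) < c"
proof -
  have "(\<Sum>y\<in>S - {x}. q x y) \<le> (\<Sum>y\<in>S. q x y)"
    using finite_states assms rate_nonneg by (intro sum_mono2) auto
  also have "\<dots> \<le> (\<Sum>x\<in>S. \<Sum>y\<in>S. q x y)"
    using finite_states assms rate_nonneg
    by (intro member_le_sum[of x S "\<lambda>x. \<Sum>y\<in>S. q x y"]) (auto intro: sum_nonneg)
  finally show ?thesis by (simp add: c_def)
qed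

lemma jump_diag_pos: "x \<in> S \<Longrightarrow> 0 < jump x x"
  using exit_rate_less[of x] c_pos by (simp add: jump_def ctmc_gen_def field_simps)

lemma jump_nonneg:
  assumes "x \<in> S" "y \<in> S" shows "0 \<le> jump x y"
proof (cases "x = y")
  case True
  then show ?thesis using jump_diag_pos[of x] assms by simp
next
  case False
  then show ?thesis using rate_nonneg[OF assms] c_pos by (simp add: jump_def ctmc_gen_def)
qed

lemma jump_row_sum:
  assumes "x \<in> S" shows "(\<Sum>y\<in>S. jump x y) = 1"
proof -
  have "(\<Sum>y\<in>S. ctmc_gen S q x y) = ctmc_gen S q x x + (\<Sum>y\<in>S - {x}. ctmc_gen S q x y)"
    using finite_states assms by (rule sum.remove)
  also have "(\<Sum>y\<in>S - {x}. ctmc_gen S q x y) = (\<Sum>y\<in>S - {x}. q x y)"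
    by (rule sum.cong) (auto simp: ctmc_gen_def)
  finally have "(\<Sum>y\<in>S. ctmc_gen S q x y) = 0" by (simp add: ctmc_gen_def)
  then show ?thesis using finite_states assms
    by (simp add: jump_def sum.distrib flip: sum_divide_distrib)
qed

lemma jump_stationary:
  assumes "y \<in> S" shows "(\<Sum>x\<in>S. pmf \<pi> x * jump x y) = pmf \<pi> y"
proof -
  have "(\<Sum>x\<in>S. pmf \<pi> x * jump x y)
      = (\<Sum>x\<in>S. (if x = y then pmf \<pi> x else 0) + pmf \<pi> x * ctmc_gen S q x y / c)"
    by (rule sum.cong) (auto simp: jump_def algebra_simps)
  then show ?thesis using finite_states assms balance[OF assms]
    by (simp add: sum.distrib flip: sum_divide_distrib)
qed

section \<open>Powers of the jump matrix and their geometric convergence\<close>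

abbreviation J :: "nat \<Rightarrow> 's \<Rightarrow> 's \<Rightarrow> real" where
  "J \<equiv> mat_pow S jump"

lemma J_nonneg: "y \<in> S \<Longrightarrow> 0 \<le> J n x y"
  by (induction n arbitrary: y) (auto intro!: sum_nonneg mult_nonneg_nonneg jump_nonneg)

lemma J_row_sum: "x \<in> S \<Longrightarrow> (\<Sum>y\<in>S. J n x y) = 1"
proof (induction n)
  case 0
  then show ?case using finite_states by simp
next
  case (Suc n)
  have "(\<Sum>y\<in>S. J (Suc n) x y) = (\<Sum>z\<in>S. \<Sum>y\<in>S. J n x z * jump z y)"
    by (simp, rule sum.swap)
  also have "\<dots> = (\<Sum>z\<in>S. J n x z)"
    by (simp add: jump_row_sum flip: sum_distrib_left)
  finally show ?case using Suc by simp
qed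

lemma J_le_1: "x \<in> S \<Longrightarrow> y \<in> S \<Longrightarrow> J n x y \<le> 1"
  using member_le_sum[of y S "J n x"] J_row_sum[of x n] J_nonneg finite_states by auto

lemma J_stationary: "y \<in> S \<Longrightarrow> (\<Sum>x\<in>S. pmf \<pi> x * J n x y) = pmf \<pi> y"
proof (induction n arbitrary: y)
  case 0
  have "(\<Sum>x\<in>S. pmf \<pi> x * J 0 x y) = (\<Sum>x\<in>S. if x = y then pmf \<pi> x else 0)"
    by (rule sum.cong) auto
  then show ?case using finite_states 0 by simp
next
  case (Suc n)
  have "(\<Sum>x\<in>S. pmf \<pi> x * J (Suc n) x y) = (\<Sum>x\<in>S. \<Sum>z\<in>S. pmf \<pi> x * J n x z * jump z y)"
    by (simp add: sum_distrib_left mult.assoc)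
  also have "\<dots> = (\<Sum>z\<in>S. \<Sum>x\<in>S. pmf \<pi> x * J n x z * jump z y)"
    by (rule sum.swap)
  also have "\<dots> = (\<Sum>z\<in>S. pmf \<pi> z * jump z y)"
    by (simp add: Suc.IH flip: sum_distrib_right)
  finally show ?case using jump_stationary Suc.prems by simp
qed

lemma J_pos_step:
  assumes "0 < J n x z" "0 < jump z y" "z \<in> S" "y \<in> S"
  shows "0 < J (Suc n) x y"
  unfolding mat_pow.simps using finite_states assms
  by (intro sum_pos2[of S z]) (auto intro!: mult_nonneg_nonneg J_nonneg jump_nonneg)

text \<open>The positive diagonal of \<open>jump\<close> lets the chain wait at \<open>y\<close>, so
  positivity once reached is never lost.\<close>

lemma J_pos_mono:
  assumes "0 < J n x y" "y \<in> S" "n \<le> m"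
  shows "0 < J m x y"
  using assms(3,1) by (induction rule: dec_induct)
    (use assms(2) J_pos_step jump_diag_pos in \<open>blast+\<close>)

lemma J_pos_ex:
  assumes "x \<in> S" "y \<in> S"
  shows "\<exists>n. 0 < J n x y"
  using irreducible[OF assms]
proof (induction rule: rtrancl_induct)
  case base
  show ?case by (rule exI[of _ 0]) simp
next
  case (step y z)
  then obtain n where n: "0 < J n x y" and yz: "y \<in> S" "z \<in> S" "0 < q y z" by auto
  have "0 < jump y z"
    using yz c_pos jump_diag_pos by (cases "y = z") (auto simp: jump_def ctmc_gen_def)
  then show ?case using J_pos_step n yz by blast
qed

text \<open>Each pair of states has its own time with a positive entry. By \<open>J_pos_mono\<close>
  any later time works too, so one time serves all pairs, and finiteness turns positivity into a
  uniform bound.\<close>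

lemma J_doeblin:
  "\<exists>e m. 0 < e \<and> e < 1 \<and> 0 < m \<and> (\<forall>x\<in>S. \<forall>y\<in>S. e \<le> J m x y)"
proof -
  obtain f where f: "\<And>x y. x \<in> S \<Longrightarrow> y \<in> S \<Longrightarrow> 0 < J (f x y) x y"
    using J_pos_ex by metis
  \<comment> \<open>The sum dominates every \<open>f x y\<close>; the successor makes
    \<open>m\<close> positive, so that an \<open>m\<close>-th root can be taken later.\<close>
  define m where "m = Suc (\<Sum>x\<in>S. \<Sum>y\<in>S. f x y)"
  have pos: "0 < J m x y" if xy: "x \<in> S" "y \<in> S" for x y
  proof (rule J_pos_mono[OF f[OF xy] xy(2)])
    have "f x y \<le> (\<Sum>y\<in>S. f x y)"
      using finite_states xy by (intro member_le_sum) auto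
    also have "\<dots> \<le> (\<Sum>x\<in>S. \<Sum>y\<in>S. f x y)"
      using finite_states xy by (intro member_le_sum[of x S "\<lambda>x. \<Sum>y\<in>S. f x y"]) auto
    finally show "f x y \<le> m" by (simp add: m_def)
  qed
  \<comment> \<open>The extra element 1/2 makes \<open>V\<close> nonempty and keeps its minimum
    below 1.\<close>
  define V where "V = insert (1/2) ((\<lambda>(x, y). J m x y) ` (S \<times> S))"
  have fin: "finite V" using finite_states by (simp add: V_def)
  have "\<forall>v\<in>V. 0 < v" using pos by (auto simp: V_def simp del: mat_pow.simps)
  then have "0 < Min V" using fin by (subst Min_gr_iff) (auto simp: V_def)
  moreover have "Min V \<le> 1/2" using fin by (intro Min_le) (auto simp: V_def)
  moreover have "Min V \<le> J m x y" if "x \<in> S" "y \<in> S" for x y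
    using fin that by (intro Min_le) (auto simp: V_def simp del: mat_pow.simps)
  moreover have "0 < m" by (simp add: m_def)
  ultimately show ?thesis by (intro exI[of _ "Min V"] exI[of _ m]) auto
qed

lemma pmf_sum_states: "(\<Sum>x\<in>S. pmf \<pi> x) = 1"
  using finite_states supp by (rule sum_pmf_eq_1)

text \<open>Since \<open>J m\<close> dominates \<open>e * pmf \<pi>\<close>, and \<open>\<pi>\<close> annihilates
  \<open>J n z y - pmf \<pi> y\<close>, multiplication by \<open>J m\<close> contracts the distance to equilibrium
  by the factor \<open>1 - e\<close>.\<close>

lemma J_convergence:
  "\<exists>r C. 0 < r \<and> r < 1 \<and> (\<forall>n. \<forall>x\<in>S. \<forall>y\<in>S. \<bar>J n x y - pmf \<pi> y\<bar> \<le> C * r ^ n)"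
proof -
  obtain e m where e: "0 < e" "e < 1" and m: "0 < m"
    and lower: "\<And>x y. x \<in> S \<Longrightarrow> y \<in> S \<Longrightarrow> e \<le> J m x y"
    using J_doeblin by blast
  \<comment> \<open>Each block of \<open>m\<close> steps contracts by \<open>1 - e\<close>; the
    \<open>m\<close>-th root expresses this as a rate per step.\<close>
  define r where "r = root m (1 - e)"
  have rm: "r ^ m = 1 - e" using m e by (simp add: r_def)
  have r: "0 < r" "r < 1" using m e by (auto simp: r_def)
  have "\<bar>J n x y - pmf \<pi> y\<bar> \<le> r ^ n / r ^ m" if "x \<in> S" "y \<in> S" for n x y
    using that
  proof (induction n arbitrary: x rule: less_induct)
    case (less n)
    show ?case
    proof (cases "n < m")
      case True
      \<comment> \<open>Before the first full block only the trivial bound 1 is available. The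
        constant \<open>1 / r ^ m\<close> is chosen so that the claimed bound is at least 1
        there.\<close>
      have "\<bar>J n x y - pmf \<pi> y\<bar> \<le> 1"
        using J_nonneg[OF less.prems(2), of n x] J_le_1[OF less.prems, of n]
          pmf_nonneg[of \<pi> y] pmf_le_1[of \<pi> y] by linarith
      also have "\<dots> \<le> r ^ n / r ^ m"
        using True r by (simp add: power_decreasing)
      finally show ?thesis .
    next
      case False
      define k where "k = n - m"
      have n: "n = m + k" and "k < n" using False m by (auto simp: k_def)
      have "(\<Sum>z\<in>S. (J m x z - e * pmf \<pi> z) * (J k z y - pmf \<pi> y))
          = (\<Sum>z\<in>S. J m x z * J k z y) - pmf \<pi> y * (\<Sum>z\<in>S. J m x z)
            - e * ((\<Sum>z\<in>S. pmf \<pi> z * J k z y) - pmf \<pi> y * (\<Sum>z\<in>S. pmf \<pi> z))"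
        unfolding sum_distrib_left sum_subtractf[symmetric]
        by (rule sum.cong) (auto simp: algebra_simps)
      also have "\<dots> = J n x y - pmf \<pi> y"
        using less.prems finite_states
        by (simp add: n mat_pow_add J_row_sum J_stationary pmf_sum_states)
      finally have "\<bar>J n x y - pmf \<pi> y\<bar>
          = \<bar>\<Sum>z\<in>S. (J m x z - e * pmf \<pi> z) * (J k z y - pmf \<pi> y)\<bar>" by simp
      also have "\<dots> \<le> (\<Sum>z\<in>S. (J m x z - e * pmf \<pi> z) * (r ^ k / r ^ m))"
      proof (rule sum_abs[THEN order_trans], rule sum_mono)
        fix z assume z: "z \<in> S"
        have "e * pmf \<pi> z \<le> e" using e pmf_le_1[of \<pi> z] by (simp add: mult_left_le)
        then have *: "0 \<le> J m x z - e * pmf \<pi> z" using lower[OF less.prems(1) z] by linarith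
        show "\<bar>(J m x z - e * pmf \<pi> z) * (J k z y - pmf \<pi> y)\<bar>
            \<le> (J m x z - e * pmf \<pi> z) * (r ^ k / r ^ m)"
          unfolding abs_mult abs_of_nonneg[OF *]
          by (intro mult_left_mono * less.IH \<open>k < n\<close> z less.prems(2))
      qed
      also have "\<dots> = (1 - e) * (r ^ k / r ^ m)"
        using less.prems
        by (simp add: sum_subtractf J_row_sum pmf_sum_states
            flip: sum_distrib_right sum_distrib_left sum_divide_distrib)
      also have "\<dots> = r ^ n / r ^ m" by (simp add: n power_add rm)
      finally show ?thesis .
    qed
  qed
  then show ?thesis using r
    by (intro exI[of _ r] exI[of _ "1 / r ^ m"]) (simp del: mat_pow.simps)
qed

section \<open>Transition probabilities as Poisson averages of jump powers\<close>

text \<open>The analytic form of \<open>exp_mat_pow_fps\<close>: both factors converge absolutely,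
  so the Cauchy product applies. Keeping \<open>exp (c * t)\<close> beside the limit leaves a plain
  exponential series weighted by \<open>J n x y\<close>, ready for termwise comparison.\<close>

lemma uniformization_sums:
  assumes "x \<in> S" "y \<in> S"
  shows "(\<lambda>n. (c * t) ^ n / fact n * J n x y) sums (exp (c * t) * ctmc_trans S q t x y)"
proof -
  let ?b = "\<lambda>n. (c * t) ^ n / fact n * J n x y"
  let ?a = "\<lambda>n. (- c * t) ^ n / fact n"
  have expn: "summable (\<lambda>n. norm ((u::real) ^ n / fact n))" for u
    using summable_norm_exp[of u] by (simp add: divide_inverse mult.commute)
  have b: "summable (\<lambda>n. norm (?b n))"
  proof (rule summable_comparison_test'[OF expn[of "c * t"]])
    fix n
    show "norm (norm (?b n)) \<le> norm ((c * t) ^ n / fact n)"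
      using J_nonneg[OF assms(2), of n x] J_le_1[OF assms, of n]
      by (simp add: abs_mult divide_right_mono mult_left_le del: mat_pow.simps)
  qed
  have suma: "suminf ?a = exp (- c * t)"
    by (simp add: exp_def divide_inverse mult.commute)
  have coeff: "t ^ n / fact n * mat_pow S (ctmc_gen S q) n x y = (\<Sum>i\<le>n. ?a i * ?b (n - i))" for n
  proof -
    have "mat_pow S (ctmc_gen S q) n x y / fact n
        = fps_nth (fps_exp (- c) * Abs_fps (\<lambda>k. c ^ k / fact k * J k x y)) n"
      using finite_states c_pos assms by (intro exp_mat_pow_fps) (auto simp: jump_def)
    also have "\<dots> = (\<Sum>i\<le>n. (- c) ^ i / fact i * (c ^ (n - i) / fact (n - i) * J (n - i) x y))"
      by (simp add: fps_mult_nth atLeast0AtMost)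
    finally have eq: "mat_pow S (ctmc_gen S q) n x y / fact n
        = (\<Sum>i\<le>n. (- c) ^ i / fact i * (c ^ (n - i) / fact (n - i) * J (n - i) x y))" .
    have "t ^ n / fact n * mat_pow S (ctmc_gen S q) n x y = t ^ n * (mat_pow S (ctmc_gen S q) n x y / fact n)"
      by simp
    also have "\<dots> = (\<Sum>i\<le>n. t ^ n * ((- c) ^ i / fact i * (c ^ (n - i) / fact (n - i) * J (n - i) x y)))"
      unfolding eq by (rule sum_distrib_left)
    also have "\<dots> = (\<Sum>i\<le>n. ?a i * ?b (n - i))"
    proof (rule sum.cong)
      fix i assume "i \<in> {..n}"
      then have "t ^ n = t ^ i * t ^ (n - i)" by (simp flip: power_add)
      then show "t ^ n * ((- c) ^ i / fact i * (c ^ (n - i) / fact (n - i) * J (n - i) x y))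
          = ?a i * ?b (n - i)"
        by (simp only: power_mult_distrib) (simp add: mult_ac)
    qed simp
    finally show ?thesis .
  qed
  have "ctmc_trans S q t x y = (\<Sum>n. \<Sum>i\<le>n. ?a i * ?b (n - i))"
    unfolding ctmc_trans_def coeff ..
  also have "\<dots> = exp (- c * t) * suminf ?b"
    using Cauchy_product[OF expn[of "- c * t"] b] unfolding suma by simp
  finally have "exp (c * t) * ctmc_trans S q t x y = suminf ?b"
    by (simp add: exp_minus field_simps)
  then show ?thesis using summable_sums[OF summable_norm_cancel[OF b]] by simp
qed

lemma exp_sums: "(\<lambda>n. u ^ n / fact n) sums exp (u::real)"
  using exp_converges[of u] by (simp add: divide_inverse mult.commute)

text \<open>Averaging the error bound \<open>C * r ^ n\<close> with the weights
  \<open>(c * t) ^ n / fact n\<close> gives \<open>C * exp (c * t * r)\<close>. Division by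
  \<open>exp (c * t)\<close> leaves exponential decay at rate \<open>c * (1 - r)\<close>.\<close>

lemma trans_tendsto:
  assumes "x \<in> S" "y \<in> S"
  shows "((\<lambda>t. ctmc_trans S q t x y) \<longlongrightarrow> pmf \<pi> y) at_top"
proof -
  obtain r C where r: "0 < r" "r < 1"
    and J: "\<And>n x y. x \<in> S \<Longrightarrow> y \<in> S \<Longrightarrow> \<bar>J n x y - pmf \<pi> y\<bar> \<le> C * r ^ n"
    using J_convergence by blast
  have bound: "\<bar>ctmc_trans S q t x y - pmf \<pi> y\<bar> \<le> C * exp (- (c * (1 - r)) * t)" if t: "0 \<le> t" for t
  proof -
    have d: "(\<lambda>n. (c * t) ^ n / fact n * (J n x y - pmf \<pi> y))
        sums (exp (c * t) * (ctmc_trans S q t x y - pmf \<pi> y))"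
      unfolding right_diff_distrib
      by (intro sums_diff uniformization_sums sums_mult2 exp_sums assms)
    have g: "(\<lambda>n. C * ((c * t * r) ^ n / fact n)) sums (C * exp (c * t * r))"
      by (intro sums_mult exp_sums)
    have le: "\<bar>(c * t) ^ n / fact n * (J n x y - pmf \<pi> y)\<bar> \<le> C * ((c * t * r) ^ n / fact n)" for n
    proof -
      have "\<bar>(c * t) ^ n / fact n * (J n x y - pmf \<pi> y)\<bar> \<le> (c * t) ^ n / fact n * (C * r ^ n)"
        using J[OF assms, of n] t c_pos by (auto simp: abs_mult intro!: mult_left_mono divide_right_mono)
      then show ?thesis by (simp add: power_mult_distrib mult_ac)
    qed
    have "exp (c * t) * (ctmc_trans S q t x y - pmf \<pi> y) \<le> C * exp (c * t * r)"
      using le by (intro sums_le[OF _ d g]) (metis abs_le_D1)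
    moreover have "- (exp (c * t) * (ctmc_trans S q t x y - pmf \<pi> y)) \<le> C * exp (c * t * r)"
      using le by (intro sums_le[OF _ sums_minus[OF d] g]) (metis abs_le_D2)
    ultimately have "\<bar>exp (c * t) * (ctmc_trans S q t x y - pmf \<pi> y)\<bar> \<le> C * exp (c * t * r)"
      by (rule abs_leI)
    then have "exp (c * t) * \<bar>ctmc_trans S q t x y - pmf \<pi> y\<bar> \<le> C * exp (c * t * r)"
      by (simp add: abs_mult)
    then have "\<bar>ctmc_trans S q t x y - pmf \<pi> y\<bar> \<le> C * exp (c * t * r) / exp (c * t)"
      by (simp add: field_simps)
    also have "\<dots> = C * exp (- (c * (1 - r)) * t)"
      by (simp add: right_diff_distrib left_diff_distrib exp_diff mult_ac)
    finally show ?thesis .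
  qed
  have "((\<lambda>t. C * exp (- (c * (1 - r)) * t)) \<longlongrightarrow> 0) at_top"
  proof -
    have "filterlim (\<lambda>t. (c * (1 - r)) * t) at_top at_top"
      using c_pos r by (intro filterlim_tendsto_pos_mult_at_top[OF tendsto_const]) (auto intro: filterlim_ident)
    then have "filterlim (\<lambda>t. - (c * (1 - r)) * t) at_bot at_top"
      by (simp add: filterlim_uminus_at_bot)
    then show ?thesis
      by (intro tendsto_mult_right_zero filterlim_compose[OF exp_at_bot])
  qed
  moreover have "\<forall>\<^sub>F t in at_top. norm (ctmc_trans S q t x y - pmf \<pi> y) \<le> C * exp (- (c * (1 - r)) * t)"
    using eventually_ge_at_top[of 0] by eventually_elim (use bound in simp)
  ultimately have "((\<lambda>t. ctmc_trans S q t x y - pmf \<pi> y) \<longlongrightarrow> 0) at_top"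
    by (rule Lim_null_comparison[rotated])
  then show ?thesis by (simp add: LIM_zero_iff)
qed

section \<open>Stationarity, uniqueness and limits of processes\<close>

text \<open>Every power of \<open>jump\<close> preserves \<pi>, hence so does their Poisson average;
  the two sides are limits of the same series.\<close>

lemma stationary: "ctmc_stationary S q \<pi>"
  unfolding ctmc_stationary_def
proof (intro conjI allI impI ballI)
  fix t :: real and y assume y: "y \<in> S"
  have "(\<lambda>n. \<Sum>x\<in>S. pmf \<pi> x * ((c * t) ^ n / fact n * J n x y))
      sums (\<Sum>x\<in>S. pmf \<pi> x * (exp (c * t) * ctmc_trans S q t x y))"
    by (intro sums_sum sums_mult uniformization_sums y)
  moreover have "(\<Sum>x\<in>S. pmf \<pi> x * ((c * t) ^ n / fact n * J n x y))
      = (c * t) ^ n / fact n * pmf \<pi> y" for n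
    unfolding J_stationary[OF y, of n, symmetric] sum_distrib_left
    by (rule sum.cong) (auto simp: mult_ac)
  moreover have "(\<lambda>n. (c * t) ^ n / fact n * pmf \<pi> y) sums (exp (c * t) * pmf \<pi> y)"
    by (intro sums_mult2 exp_sums)
  ultimately have "(\<Sum>x\<in>S. pmf \<pi> x * (exp (c * t) * ctmc_trans S q t x y)) = exp (c * t) * pmf \<pi> y"
    using sums_unique2 by (simp del: mat_pow.simps)
  moreover have "(\<Sum>x\<in>S. pmf \<pi> x * (exp (c * t) * ctmc_trans S q t x y))
      = exp (c * t) * (\<Sum>x\<in>S. pmf \<pi> x * ctmc_trans S q t x y)"
    by (simp add: sum_distrib_left mult_ac)
  ultimately show "(\<Sum>x\<in>S. pmf \<pi> x * ctmc_trans S q t x y) = pmf \<pi> y" by simp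
qed (rule supp)

text \<open>The weights \<mu> stand both for a competing stationary law in
  \<open>stationary_unique\<close> and for the initial law of a process in
  \<open>process_tendsto\<close>.\<close>

lemma mixture_tendsto:
  assumes "y \<in> S" "(\<Sum>x\<in>S. \<mu> x) = 1"
  shows "((\<lambda>t. \<Sum>x\<in>S. \<mu> x * ctmc_trans S q t x y) \<longlongrightarrow> pmf \<pi> y) at_top"
proof -
  have "((\<lambda>t. \<Sum>x\<in>S. \<mu> x * ctmc_trans S q t x y) \<longlongrightarrow> (\<Sum>x\<in>S. \<mu> x * pmf \<pi> y)) at_top"
    by (intro tendsto_sum tendsto_mult tendsto_const trans_tendsto assms(1))
  then show ?thesis using assms(2) by (simp flip: sum_distrib_right)
qed

text \<open>Started from \<rho>, the mixture is constant for nonnegative times, yet it converges to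
  \<pi>.\<close>

lemma stationary_unique:
  assumes "ctmc_stationary S q \<rho>"
  shows "\<rho> = \<pi>"
proof (rule pmf_eqI)
  fix y
  have \<rho>: "set_pmf \<rho> \<subseteq> S" using assms by (simp add: ctmc_stationary_def)
  show "pmf \<rho> y = pmf \<pi> y"
  proof (cases "y \<in> S")
    case True
    have "((\<lambda>t. \<Sum>x\<in>S. pmf \<rho> x * ctmc_trans S q t x y) \<longlongrightarrow> pmf \<pi> y) at_top"
      using True sum_pmf_eq_1[OF finite_states \<rho>] by (rule mixture_tendsto)
    moreover have "\<forall>\<^sub>F t in at_top. (\<Sum>x\<in>S. pmf \<rho> x * ctmc_trans S q t x y) = pmf \<rho> y"
      using eventually_ge_at_top[of 0]
      by eventually_elim (use assms True in \<open>simp add: ctmc_stationary_def\<close>)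
    ultimately have "((\<lambda>t. pmf \<rho> y) \<longlongrightarrow> pmf \<pi> y) (at_top :: real filter)"
      by (simp cong: tendsto_cong)
    then show ?thesis by (simp add: tendsto_const_iff)
  next
    case False
    then show ?thesis using \<rho> supp by (metis pmf_eq_0_set_pmf subsetD)
  qed
qed

text \<open>The law at time \<open>t\<close> is the mixture of transition probabilities over the law
  at time 0. Only the joint distribution at these two times is used.\<close>

lemma process_tendsto:
  assumes X: "ctmc_process M S q X"
  shows "((\<lambda>t. measure M {\<omega> \<in> space M. P (X t \<omega>)}) \<longlongrightarrow> measure_pmf.prob \<pi> {x. P x}) at_top"
proof -
  interpret prob_space M using X by (simp add: ctmc_process_def)
  have meas: "X t \<in> measurable M (count_space S)" if "0 \<le> t" for t
    using X that by (simp add: ctmc_process_def)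
  have X_in: "X t \<omega> \<in> S" if "0 \<le> t" "\<omega> \<in> space M" for t \<omega>
    using measurable_space[OF meas[OF that(1)] that(2)] by simp
  have ev: "{\<omega> \<in> space M. X t \<omega> = x} \<in> events" if "0 \<le> t" "x \<in> S" for t x
    using measurable_sets[OF meas[OF that(1)], of "{x}"] that(2)
    by (simp add: vimage_def Int_def conj_commute)
  have total: "(\<Sum>x\<in>S. prob {\<omega> \<in> space M. X 0 \<omega> = x}) = 1"
  proof -
    have "(\<Sum>x\<in>S. prob {\<omega> \<in> space M. X 0 \<omega> = x}) = prob (\<Union>x\<in>S. {\<omega> \<in> space M. X 0 \<omega> = x})"
      using ev finite_states
      by (intro finite_measure_finite_Union[symmetric]) (auto simp: disjoint_family_on_def)
    also have "(\<Union>x\<in>S. {\<omega> \<in> space M. X 0 \<omega> = x}) = space M" using X_in by auto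
    finally show ?thesis by (simp add: prob_space)
  qed
  have joint: "prob {\<omega> \<in> space M. X 0 \<omega> = x \<and> X t \<omega> = y}
      = prob {\<omega> \<in> space M. X 0 \<omega> = x} * ctmc_trans S q t x y"
    if "0 < t" "x \<in> S" "y \<in> S" for t x y
  proof -
    \<comment> \<open>The Markov property is instantiated with \<open>n = 0\<close>: the times are 0
      and \<open>t\<close>, the states \<open>x\<close> and \<open>y\<close>.\<close>
    define \<tau> where "\<tau> = (\<lambda>n::nat. if n = 0 then 0 else t)"
    define s where "s = (\<lambda>n::nat. if n = 0 then x else y)"
    have "prob {\<omega> \<in> space M. \<forall>j\<le>Suc 0. X (\<tau> j) \<omega> = s j} =
        prob {\<omega> \<in> space M. \<forall>j\<le>0. X (\<tau> j) \<omega> = s j} *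
          ctmc_trans S q (\<tau> (Suc 0) - \<tau> 0) (s 0) (s (Suc 0))"
      using X that unfolding ctmc_process_def
      by (elim conjE allE[where x = 0] allE[where x = \<tau>] allE[where x = s])
        (auto simp: \<tau>_def s_def)
    moreover have "(\<forall>j\<le>Suc 0. X (\<tau> j) \<omega> = s j) \<longleftrightarrow> X 0 \<omega> = x \<and> X t \<omega> = y" for \<omega>
      by (auto simp: \<tau>_def s_def le_Suc_eq)
    ultimately show ?thesis by (simp add: \<tau>_def s_def)
  qed
  have marg: "prob {\<omega> \<in> space M. X t \<omega> = y}
      = (\<Sum>x\<in>S. prob {\<omega> \<in> space M. X 0 \<omega> = x} * ctmc_trans S q t x y)"
    if t: "0 < t" and y: "y \<in> S" for t y
  proof -
    have "{\<omega> \<in> space M. X t \<omega> = y} = (\<Union>x\<in>S. {\<omega> \<in> space M. X 0 \<omega> = x \<and> X t \<omega> = y})"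
      using X_in by auto
    moreover have "{\<omega> \<in> space M. X 0 \<omega> = x \<and> X t \<omega> = y} \<in> events" if "x \<in> S" for x
      using sets.Int[OF ev[of 0 x] ev[of t y]] t y that
      by (simp add: Collect_conj_eq[symmetric] Int_def conj_ac)
    ultimately have "prob {\<omega> \<in> space M. X t \<omega> = y}
        = (\<Sum>x\<in>S. prob {\<omega> \<in> space M. X 0 \<omega> = x \<and> X t \<omega> = y})"
      using finite_states
      by (simp, intro finite_measure_finite_Union) (auto simp: disjoint_family_on_def)
    then show ?thesis using joint t y by simp
  qed
  let ?T = "{y \<in> S. P y}"
  have fT: "finite ?T" using finite_states by simp
  have lim: "((\<lambda>t. \<Sum>y\<in>?T. \<Sum>x\<in>S. prob {\<omega> \<in> space M. X 0 \<omega> = x} * ctmc_trans S q t x y)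
      \<longlongrightarrow> (\<Sum>y\<in>?T. pmf \<pi> y)) at_top"
    by (intro tendsto_sum mixture_tendsto total) auto
  have eq: "\<forall>\<^sub>F t in at_top. prob {\<omega> \<in> space M. P (X t \<omega>)}
      = (\<Sum>y\<in>?T. \<Sum>x\<in>S. prob {\<omega> \<in> space M. X 0 \<omega> = x} * ctmc_trans S q t x y)"
    \<comment> \<open>Strict positivity of \<open>t\<close> is required because the Markov property
      speaks of strictly increasing times.\<close>
    using eventually_gt_at_top[of 0]
  proof eventually_elim
    case (elim t)
    have "{\<omega> \<in> space M. P (X t \<omega>)} = (\<Union>y\<in>?T. {\<omega> \<in> space M. X t \<omega> = y})"
      using X_in elim by auto
    then have "prob {\<omega> \<in> space M. P (X t \<omega>)} = (\<Sum>y\<in>?T. prob {\<omega> \<in> space M. X t \<omega> = y})"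
      using fT ev elim
      by (simp, intro finite_measure_finite_Union) (auto simp: disjoint_family_on_def)
    then show ?case using marg elim by simp
  qed
  \<comment> \<open>The predicate may also hold outside \<open>S\<close>, but \<pi> gives no mass
    there.\<close>
  have "measure_pmf.prob \<pi> {x. P x} = measure_pmf.prob \<pi> ?T"
    using supp by (intro measure_pmf.finite_measure_eq_AE) (auto simp: AE_measure_pmf_iff)
  also have "\<dots> = (\<Sum>y\<in>?T. pmf \<pi> y)" using fT by (rule measure_measure_pmf_finite)
  finally show ?thesis using lim tendsto_cong[OF eq] by simp
qed

end

section \<open>The exclusion process\<close>

text \<open>Cross-multiplied form, so that nothing is divided by \<open>g (x i)\<close>.\<close>

lemma prod_fun_upd:
  fixes g :: "'b \<Rightarrow> real"
  assumes "finite I" "i \<in> I"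
  shows "(\<Prod>l\<in>I. g ((x(i := b)) l)) * g (x i) = (\<Prod>l\<in>I. g (x l)) * g b"
proof -
  have "(\<Prod>l\<in>I - {i}. g ((x(i := b)) l)) = (\<Prod>l\<in>I - {i}. g (x l))"
    by (rule prod.cong) auto
  then show ?thesis using assms by (simp add: prod.remove)
qed

locale ssep =
  fixes N K :: nat and \<alpha> \<beta> \<delta> :: "nat \<Rightarrow> real"
  assumes N: "N \<ge> 2"
    and \<alpha>_pos: "\<And>k. k \<in> {1..K} \<Longrightarrow> \<alpha> k > 0"
    and \<beta>_pos: "\<And>k. k \<in> {1..K} \<Longrightarrow> \<beta> k > 0"
    and \<delta>_pos: "\<And>k. k \<in> {1..K} \<Longrightarrow> \<delta> k > 0"
begin

abbreviation G :: "(nat \<Rightarrow> nat) set" where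
  "G \<equiv> ssep_states N K"

abbreviation q :: "(nat \<Rightarrow> nat) \<Rightarrow> (nat \<Rightarrow> nat) \<Rightarrow> real" where
  "q \<equiv> ssep_rate N K \<alpha> \<beta> \<delta>"

definition Z :: real where
  "Z = 1 + (\<Sum>l=1..K. \<alpha> l / \<beta> l)"

definition site_weight :: "nat \<Rightarrow> real" where
  "site_weight k = (if k = 0 then 1 / Z else if k \<le> K then \<alpha> k / \<beta> k * inverse Z else 0)"

definition site_pmf :: "nat pmf" where
  "site_pmf = embed_pmf site_weight"

text \<open>The default value \<open>undefined\<close> off the sites matches the extensional
  functions that make up \<open>G\<close>.\<close>

definition equilibrium :: "(nat \<Rightarrow> nat) pmf" where
  "equilibrium = Pi_pmf {1..N} undefined (\<lambda>_. site_pmf)"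

lemma Z_pos: "0 < Z"
proof -
  have "0 \<le> (\<Sum>l=1..K. \<alpha> l / \<beta> l)"
    using \<alpha>_pos \<beta>_pos by (intro sum_nonneg) (auto intro!: divide_nonneg_nonneg less_imp_le)
  then show ?thesis by (simp add: Z_def)
qed

lemma site_weight_pos: "k \<le> K \<Longrightarrow> 0 < site_weight k"
  using Z_pos \<alpha>_pos[of k] \<beta>_pos[of k] by (auto simp: site_weight_def)

lemma site_weight_nonneg: "0 \<le> site_weight k"
  using site_weight_pos[of k] by (cases "k \<le> K") (auto simp: site_weight_def)

lemma sum_site_weight: "(\<Sum>k\<le>K. site_weight k) = 1"
proof -
  have "(\<Sum>k\<le>K. site_weight k) = site_weight 0 + (\<Sum>k=1..K. site_weight k)"
    by (simp add: atMost_atLeast0 sum.atLeast_Suc_atMost)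
  also have "(\<Sum>k=1..K. site_weight k) = (\<Sum>k=1..K. \<alpha> k / \<beta> k) * inverse Z"
    unfolding sum_distrib_right by (rule sum.cong) (auto simp: site_weight_def)
  also have "site_weight 0 + \<dots> = Z * inverse Z"
    by (simp add: site_weight_def Z_def field_simps)
  finally show ?thesis using Z_pos by simp
qed

lemma pmf_site: "pmf site_pmf k = site_weight k"
  unfolding site_pmf_def
proof (rule pmf_embed_pmf)
  have "(\<integral>\<^sup>+k. ennreal (site_weight k) \<partial>count_space UNIV) = (\<Sum>k\<le>K. ennreal (site_weight k))"
    by (rule nn_integral_count_space') (auto simp: site_weight_def)
  also have "\<dots> = 1"
    by (simp add: sum_ennreal site_weight_nonneg sum_site_weight)
  finally show "(\<integral>\<^sup>+k. ennreal (site_weight k) \<partial>count_space UNIV) = 1" .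
qed (rule site_weight_nonneg)

lemma pmf_equilibrium: "x \<in> G \<Longrightarrow> pmf equilibrium x = (\<Prod>i\<in>{1..N}. site_weight (x i))"
  unfolding equilibrium_def by (subst pmf_Pi) (auto simp: ssep_states_def PiE_def extensional_def pmf_site)

lemma state_le: "x \<in> G \<Longrightarrow> i \<in> {1..N} \<Longrightarrow> x i \<le> K"
  by (auto simp: ssep_states_def PiE_def Pi_def)

lemma state_upd: "x \<in> G \<Longrightarrow> i \<in> {1..N} \<Longrightarrow> k \<le> K \<Longrightarrow> x(i := k) \<in> G"
  by (auto simp: ssep_states_def PiE_def Pi_def extensional_def)

lemma pmf_equilibrium_pos: "x \<in> G \<Longrightarrow> 0 < pmf equilibrium x"
  unfolding pmf_equilibrium by (intro prod_pos ballI site_weight_pos state_le)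

lemma equilibrium_upd:
  assumes "x \<in> G" "i \<in> {1..N}" "k \<le> K"
  shows "pmf equilibrium (x(i := k)) * site_weight (x i) = pmf equilibrium x * site_weight k"
  using prod_fun_upd[of "{1..N}" i site_weight x k] assms by (simp add: pmf_equilibrium state_upd)

lemma set_equilibrium: "set_pmf equilibrium \<subseteq> G"
proof -
  have "set_pmf site_pmf \<subseteq> {0..K}"
    by (auto simp: set_pmf_iff pmf_site site_weight_def split: if_splits)
  then show ?thesis
    unfolding equilibrium_def ssep_states_def
    by (subst set_Pi_pmf) (auto simp: PiE_dflt_def PiE_def extensional_def)
qed

lemma equilibrium_marginal: "i \<in> {1..N} \<Longrightarrow> map_pmf (\<lambda>x. x i) equilibrium = site_pmf"
  unfolding equilibrium_def by (subst Pi_pmf_component) auto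

section \<open>Reversibility\<close>

text \<open>Filling a vacant site with type \<open>k\<close> multiplies the product weight by
  \<open>\<alpha> k / \<beta> k\<close>, exactly the ratio of the two rates. The two conditions
  describe the same pair of configurations.\<close>

lemma arrival_departure_balance:
  assumes "x \<in> G" "y \<in> G" "k \<in> {1..K}" "i \<in> {1..N}"
  shows "pmf equilibrium x * (if x i = 0 \<and> y = x(i := k) then \<alpha> k else 0)
    = pmf equilibrium y * (if y i = k \<and> x = y(i := 0) then \<beta> k else 0)"
proof (cases "x i = 0 \<and> y = x(i := k)")
  case True
  have "pmf equilibrium y * (1 / Z) = pmf equilibrium x * (\<alpha> k / \<beta> k * inverse Z)"
    using equilibrium_upd[OF assms(1,4), of k] True assms(3) by (simp add: site_weight_def)
  then have "pmf equilibrium x * \<alpha> k = pmf equilibrium y * \<beta> k"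
    using Z_pos \<beta>_pos[OF assms(3)] by (simp add: field_simps)
  moreover have *: "y i = k \<and> x = y(i := 0)" using True by auto
  ultimately show ?thesis unfolding if_P[OF True] if_P[OF *] by simp
next
  case False
  then have "\<not> (y i = k \<and> x = y(i := 0))" by auto
  then show ?thesis unfolding if_not_P[OF False] by (simp only: if_False mult_zero_right)
qed

text \<open>A hop exchanges the contents of two sites and so preserves the product weight, while
  both directions have rate \<open>\<delta> k\<close>.\<close>

lemma hop_balance:
  assumes "x \<in> G" "y \<in> G" "k \<in> {1..K}" "i \<in> {1..N}" "j \<in> {1..N}" "i \<noteq> j"
  shows "pmf equilibrium x * (if x i = k \<and> x j = 0 \<and> y = x(i := 0, j := k) then \<delta> k else 0)
    = pmf equilibrium y * (if y j = k \<and> y i = 0 \<and> x = y(j := 0, i := k) then \<delta> k else 0)"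
proof (cases "x i = k \<and> x j = 0 \<and> y = x(i := 0, j := k)")
  case True
  \<comment> \<open>The comparison passes through the configuration with the moving particle
    removed, so that each step changes a single site.\<close>
  have *: "x(i := 0) \<in> G" using assms by (intro state_upd) auto
  have "pmf equilibrium (x(i := 0)) * site_weight k = pmf equilibrium x * site_weight 0"
    using equilibrium_upd[OF assms(1,4), of 0] True by simp
  moreover have "pmf equilibrium y * site_weight 0 = pmf equilibrium (x(i := 0)) * site_weight k"
    using equilibrium_upd[OF * assms(5), of k] True assms(3,6) by simp
  ultimately have "pmf equilibrium x = pmf equilibrium y"
    using site_weight_pos[of 0] by simp
  moreover have *: "y j = k \<and> y i = 0 \<and> x = y(j := 0, i := k)"
    using True assms(6) by auto
  ultimately show ?thesis unfolding if_P[OF True] if_P[OF *] by simp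
next
  case False
  then have "\<not> (y j = k \<and> y i = 0 \<and> x = y(j := 0, i := k))" using assms(6) by auto
  then show ?thesis unfolding if_not_P[OF False] by (simp only: if_False mult_zero_right)
qed

definition arrival :: "nat \<Rightarrow> (nat \<Rightarrow> nat) \<Rightarrow> (nat \<Rightarrow> nat) \<Rightarrow> real" where
  "arrival k x y = (\<Sum>i\<in>{1, N}. if x i = 0 \<and> y = x(i := k) then \<alpha> k else 0)"

definition departure :: "nat \<Rightarrow> (nat \<Rightarrow> nat) \<Rightarrow> (nat \<Rightarrow> nat) \<Rightarrow> real" where
  "departure k x y = (\<Sum>i\<in>{1, N}. if x i = k \<and> y = x(i := 0) then \<beta> k else 0)"

definition hop :: "nat \<Rightarrow> (nat \<Rightarrow> nat) \<Rightarrow> (nat \<Rightarrow> nat) \<Rightarrow> real" where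
  "hop k x y = (\<Sum>i=1..N. \<Sum>j\<in>{j \<in> {1..N}. j = i + 1 \<or> i = j + 1}.
     if x i = k \<and> x j = 0 \<and> y = x(i := 0, j := k) then \<delta> k else 0)"

lemma rate_split: "q x y = (\<Sum>k=1..K. arrival k x y + departure k x y + hop k x y)"
  unfolding ssep_rate_def arrival_def departure_def hop_def ..

text \<open>Transitions are matched type by type: arrivals with departures, and each hop with its
  reverse.\<close>

lemma detailed_balance:
  assumes "x \<in> G" "y \<in> G"
  shows "pmf equilibrium x * q x y = pmf equilibrium y * q y x"
proof -
  have ends: "i \<in> {1..N}" if "i \<in> {1, N}" for i using that N by auto
  \<comment> \<open>General in \<open>u\<close> and \<open>v\<close>, since it is applied in both
    orders: once for the arrivals from \<open>x\<close> to \<open>y\<close>, once for the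
    departures.\<close>
  have ad: "pmf equilibrium u * arrival k u v = pmf equilibrium v * departure k v u"
    if "u \<in> G" "v \<in> G" "k \<in> {1..K}" for u v k
    unfolding arrival_def departure_def sum_distrib_left
    by (intro sum.cong refl arrival_departure_balance that ends)
  have hh: "pmf equilibrium x * hop k x y = pmf equilibrium y * hop k y x" if "k \<in> {1..K}" for k
  proof -
    have "pmf equilibrium x * hop k x y
        = (\<Sum>i=1..N. \<Sum>j\<in>{j \<in> {1..N}. j = i + 1 \<or> i = j + 1}.
            pmf equilibrium y * (if y j = k \<and> y i = 0 \<and> x = y(j := 0, i := k) then \<delta> k else 0))"
      unfolding hop_def sum_distrib_left
      by (intro sum.cong refl hop_balance assms that) auto
    \<comment> \<open>Adjacency is symmetric, so exchanging the two sums turns the hops from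
      \<open>i\<close> to \<open>j\<close> into those from \<open>j\<close> to
      \<open>i\<close>.\<close>
    also have "\<dots> = (\<Sum>j=1..N. \<Sum>i\<in>{i \<in> {1..N}. j = i + 1 \<or> i = j + 1}.
            pmf equilibrium y * (if y j = k \<and> y i = 0 \<and> x = y(j := 0, i := k) then \<delta> k else 0))"
      by (rule sum.swap_restrict) auto
    also have "\<dots> = pmf equilibrium y * hop k y x"
      unfolding hop_def sum_distrib_left
      by (intro sum.cong refl) auto
    finally show ?thesis .
  qed
  show ?thesis
    unfolding rate_split sum_distrib_left
  proof (rule sum.cong)
    fix k assume k: "k \<in> {1..K}"
    show "pmf equilibrium x * (arrival k x y + departure k x y + hop k x y)
        = pmf equilibrium y * (arrival k y x + departure k y x + hop k y x)"
      using ad[OF assms k] ad[OF assms(2,1) k] hh[OF k] by (simp add: distrib_left)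
  qed simp
qed

section \<open>Irreducibility of the exclusion process\<close>

lemma arrival_nonneg: "k \<in> {1..K} \<Longrightarrow> 0 \<le> arrival k x y"
  unfolding arrival_def by (intro sum_nonneg) (auto simp: less_imp_le \<alpha>_pos)

lemma departure_nonneg: "k \<in> {1..K} \<Longrightarrow> 0 \<le> departure k x y"
  unfolding departure_def by (intro sum_nonneg) (auto simp: less_imp_le \<beta>_pos)

lemma hop_nonneg: "k \<in> {1..K} \<Longrightarrow> 0 \<le> hop k x y"
  unfolding hop_def by (intro sum_nonneg) (auto simp: less_imp_le \<delta>_pos)

lemma rate_nonneg: "0 \<le> q x y"
  unfolding rate_split
  by (intro sum_nonneg add_nonneg_nonneg arrival_nonneg departure_nonneg hop_nonneg)

text \<open>Departures and hops suffice for emptying a configuration; the way back comes from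
  \<open>sym_jumps\<close>.\<close>

lemma rate_pos:
  assumes k: "k \<in> {1..K}" and "0 < departure k x y \<or> 0 < hop k x y"
  shows "0 < q x y"
  unfolding rate_split
proof (rule sum_pos2[OF _ k])
  show "0 < arrival k x y + departure k x y + hop k x y"
    using assms(2) arrival_nonneg[OF k, of x y] departure_nonneg[OF k, of x y] hop_nonneg[OF k, of x y]
    by linarith
qed (auto intro!: add_nonneg_nonneg arrival_nonneg departure_nonneg hop_nonneg)

lemma departure_rate_pos:
  assumes "x \<in> G" "x 1 \<noteq> 0"
  shows "0 < q x (x(1 := 0))"
proof -
  have k: "x 1 \<in> {1..K}" using assms state_le[of x 1] N by auto
  have "0 < departure (x 1) x (x(1 := 0))"
    unfolding departure_def by (rule sum_pos2[of _ 1]) (use \<beta>_pos[OF k] in auto)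
  then show ?thesis using rate_pos[OF k] by blast
qed

lemma hop_rate_pos:
  assumes "x \<in> G" "i \<in> {1..N}" "j \<in> {1..N}" "i = j + 1" "x i \<noteq> 0" "x j = 0"
  shows "0 < q x (x(i := 0, j := x i))"
proof -
  have k: "x i \<in> {1..K}" using assms state_le[of x i] by auto
  have "0 < hop (x i) x (x(i := 0, j := x i))"
    unfolding hop_def
  proof (rule sum_pos2[OF _ assms(2)])
    show "0 < (\<Sum>j'\<in>{j' \<in> {1..N}. j' = i + 1 \<or> i = j' + 1}.
        if x i = x i \<and> x j' = 0 \<and> x(i := 0, j := x i) = x(i := 0, j' := x i) then \<delta> (x i) else 0)"
      by (rule sum_pos2[of _ j]) (use assms \<delta>_pos[OF k] in auto)
  qed (use \<delta>_pos[OF k] in \<open>auto intro!: sum_nonneg\<close>)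
  then show ?thesis using rate_pos[OF k] by blast
qed

abbreviation jumps :: "((nat \<Rightarrow> nat) \<times> (nat \<Rightarrow> nat)) set" where
  "jumps \<equiv> {(x, y). x \<in> G \<and> y \<in> G \<and> 0 < q x y}"

abbreviation vacant :: "nat \<Rightarrow> nat" where
  "vacant \<equiv> restrict (\<lambda>_. 0) {1..N}"

text \<open>The leftmost particle can always move one step to the left (leaving the system from site 1),
  which decreases the sum of the positions of all particles.\<close>

lemma reaches_vacant: "x \<in> G \<Longrightarrow> (x, vacant) \<in> jumps\<^sup>*"
proof (induction "\<Sum>i | i \<in> {1..N} \<and> x i \<noteq> 0. i" arbitrary: x rule: less_induct)
  case less
  let ?O = "\<lambda>x::nat\<Rightarrow>nat. {i \<in> {1..N}. x i \<noteq> 0}"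
  have fin: "finite (?O x)" by simp
  show ?case
  proof (cases "?O x = {}")
    case True
    then have "x = vacant"
      using less.prems by (auto simp: ssep_states_def PiE_def extensional_def fun_eq_iff)
    then show ?thesis by simp
  next
    case False
    define i where "i = Min (?O x)"
    have i: "i \<in> {1..N}" "x i \<noteq> 0" and least: "\<And>j. j \<in> ?O x \<Longrightarrow> i \<le> j"
      using Min_in[OF fin False] Min_le[OF fin] by (auto simp: i_def)
    have sum_x: "(\<Sum>l\<in>?O x. l) = i + (\<Sum>l\<in>?O x - {i}. l)"
      using i fin by (intro sum.remove) auto
    have "\<exists>y\<in>G. 0 < q x y \<and> (\<Sum>l\<in>?O y. l) < (\<Sum>l\<in>?O x. l)"
    proof (cases "i = 1")
      case True
      have "?O (x(1 := 0)) = ?O x - {i}" using True by auto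
      then show ?thesis
        using sum_x i True departure_rate_pos[OF less.prems]
        by (intro bexI[of _ "x(1 := 0)"] state_upd less.prems) auto
    next
      case False
      define j where "j = i - 1"
      have j: "j \<in> {1..N}" "i = j + 1" using i False by (auto simp: j_def)
      have xj: "x j = 0" using least[of j] j by auto
      have "?O (x(i := 0, j := x i)) = insert j (?O x - {i})" using i j by auto
      moreover have "(\<Sum>l\<in>insert j (?O x - {i}). l) = j + (\<Sum>l\<in>?O x - {i}. l)"
        using fin xj by (intro sum.insert) auto
      ultimately have "(\<Sum>l\<in>?O (x(i := 0, j := x i)). l) < (\<Sum>l\<in>?O x. l)"
        using sum_x j by simp
      moreover have "x(i := 0, j := x i) \<in> G"
        using state_upd[OF state_upd[OF less.prems i(1), of 0] j(1) state_le[OF less.prems i(1)]] by simp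
      ultimately show ?thesis
        using hop_rate_pos[OF less.prems i(1) j(1,2) i(2) xj] by blast
    qed
    then obtain y where y: "y \<in> G" "0 < q x y" "(\<Sum>l\<in>?O y. l) < (\<Sum>l\<in>?O x. l)" by blast
    have "(x, y) \<in> jumps" using y less.prems by simp
    then show ?thesis using less.hyps[OF y(3,1)] by (rule converse_rtrancl_into_rtrancl)
  qed
qed

text \<open>By detailed balance and strictly positive weights, a jump is possible exactly when its
  reverse is. Paths to \<open>vacant\<close> can therefore be reversed.\<close>

lemma sym_jumps: "sym jumps"
proof (rule symI)
  fix x y assume "(x, y) \<in> jumps"
  then have xy: "x \<in> G" "y \<in> G" "0 < q x y" by auto
  have "0 < pmf equilibrium y * q y x"
    using detailed_balance[OF xy(1,2)] pmf_equilibrium_pos[OF xy(1)] xy(3) by (metis mult_pos_pos)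
  then show "(y, x) \<in> jumps"
    using xy pmf_equilibrium_pos[OF xy(2)] by (simp add: zero_less_mult_iff)
qed

section \<open>The general theory applied to the exclusion process\<close>

text \<open>Any two configurations are joined through \<open>vacant\<close>, the second path being
  reversed. Summing detailed balance over \<open>x\<close> equates the inflow into \<open>y\<close>
  with its outflow, which cancels the diagonal term of the generator.\<close>

sublocale irreducible_ctmc G q equilibrium
proof
  show fin: "finite G" by (simp add: ssep_states_def finite_PiE)
  show "0 \<le> q x y" for x y by (rule rate_nonneg)
  show "(x, y) \<in> jumps\<^sup>*" if "x \<in> G" "y \<in> G" for x y
    using reaches_vacant[OF that(1)] symD[OF sym_rtrancl[OF sym_jumps] reaches_vacant[OF that(2)]]
    by (rule rtrancl_trans)
  show "set_pmf equilibrium \<subseteq> G" by (rule set_equilibrium)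
  show "(\<Sum>x\<in>G. pmf equilibrium x * ctmc_gen G q x y) = 0" if y: "y \<in> G" for y
  proof -
    have "(\<Sum>x\<in>G. pmf equilibrium x * ctmc_gen G q x y)
        = pmf equilibrium y * ctmc_gen G q y y + (\<Sum>x\<in>G - {y}. pmf equilibrium x * ctmc_gen G q x y)"
      using fin y by (rule sum.remove)
    also have "(\<Sum>x\<in>G - {y}. pmf equilibrium x * ctmc_gen G q x y)
        = (\<Sum>x\<in>G - {y}. pmf equilibrium y * q y x)"
      using y by (intro sum.cong) (auto simp: ctmc_gen_def detailed_balance)
    also have "pmf equilibrium y * ctmc_gen G q y y + \<dots> = 0"
      by (simp add: ctmc_gen_def sum_distrib_left)
    finally show ?thesis .
  qed
qed

lemma equilibrium_site:
  assumes "i \<in> {1..N}"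
  shows "measure_pmf.prob equilibrium {x. x i = k} = site_weight k"
  using pmf_map[of "\<lambda>x. x i" equilibrium k] equilibrium_marginal[OF assms]
  by (simp add: pmf_site vimage_def)

end

text \<open>Both readings of a steady probability are covered: mass under the stationary law, and
  the limit in time from an arbitrary initial law.\<close>

theorem theorem3:
  fixes N K :: nat and \<alpha> \<beta> \<delta> :: "nat \<Rightarrow> real" and M :: "'w measure"
  assumes "N \<ge> 2" and "K \<ge> 1"
    and "\<And>k. k \<in> {1..K} \<Longrightarrow> \<alpha> k > 0"
    and "\<And>k. k \<in> {1..K} \<Longrightarrow> \<beta> k > 0"
    and "\<And>k. k \<in> {1..K} \<Longrightarrow> \<delta> k > 0"
  defines "G \<equiv> ssep_states N K"
    and "q \<equiv> ssep_rate N K \<alpha> \<beta> \<delta>"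
    and "Z \<equiv> 1 + (\<Sum>l=1..K. \<alpha> l / \<beta> l)"
  shows "(\<exists>!\<pi>. ctmc_stationary G q \<pi>) \<and>
    (\<forall>\<pi>. ctmc_stationary G q \<pi> \<longrightarrow>
       (\<forall>i\<in>{1..N}. \<forall>j\<in>{1..N}. map_pmf (\<lambda>x. x i) \<pi> = map_pmf (\<lambda>x. x j) \<pi>) \<and>
       (\<forall>i\<in>{1..N}. measure_pmf.prob \<pi> {x. x i = 0} = 1 / Z) \<and>
       (\<forall>i\<in>{1..N}. \<forall>k\<in>{1..K}. measure_pmf.prob \<pi> {x. x i = k} = \<alpha> k / \<beta> k * inverse Z)) \<and>
    (\<forall>X. ctmc_process M G q X \<longrightarrow>
       (\<forall>i\<in>{1..N}. ((\<lambda>t. measure M {\<omega> \<in> space M. X t \<omega> i = 0}) \<longlongrightarrow> 1 / Z) at_top) \<and>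
       (\<forall>i\<in>{1..N}. \<forall>k\<in>{1..K}.
          ((\<lambda>t. measure M {\<omega> \<in> space M. X t \<omega> i = k}) \<longlongrightarrow> \<alpha> k / \<beta> k * inverse Z) at_top))"
proof -
  interpret S: ssep N K \<alpha> \<beta> \<delta>
    using assms(1,3-5) by unfold_locales
  \<comment> \<open>This equivalence yields existence and uniqueness at once and reduces every claim
    about stationary laws to the product measure.\<close>
  have stat: "ctmc_stationary G q \<pi> \<longleftrightarrow> \<pi> = S.equilibrium" for \<pi>
    unfolding G_def q_def using S.stationary S.stationary_unique by blast
  have weights: "S.site_weight 0 = 1 / Z"
    "\<And>k. k \<in> {1..K} \<Longrightarrow> S.site_weight k = \<alpha> k / \<beta> k * inverse Z"
    by (simp_all add: S.site_weight_def S.Z_def Z_def)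
  have lim: "((\<lambda>t. measure M {\<omega> \<in> space M. X t \<omega> i = k}) \<longlongrightarrow> S.site_weight k) at_top"
    if "ctmc_process M G q X" "i \<in> {1..N}" for X i k
    using S.process_tendsto[of M X "\<lambda>x. x i = k"] that
    by (simp add: G_def q_def S.equilibrium_site)
  have prob0: "measure_pmf.prob S.equilibrium {x. x i = 0} = 1 / Z" if "i \<in> {1..N}" for i
    using S.equilibrium_site[OF that, of 0] weights(1) by simp
  have probk: "measure_pmf.prob S.equilibrium {x. x i = k} = \<alpha> k / \<beta> k * inverse Z"
    if "i \<in> {1..N}" "k \<in> {1..K}" for i k
    using S.equilibrium_site[OF that(1), of k] weights(2)[OF that(2)] by simp
  have lim0: "((\<lambda>t. measure M {\<omega> \<in> space M. X t \<omega> i = 0}) \<longlongrightarrow> 1 / Z) at_top"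
    if "ctmc_process M G q X" "i \<in> {1..N}" for X i
    using lim[OF that, of 0] weights(1) by simp
  have limk: "((\<lambda>t. measure M {\<omega> \<in> space M. X t \<omega> i = k}) \<longlongrightarrow> \<alpha> k / \<beta> k * inverse Z) at_top"
    if "ctmc_process M G q X" "i \<in> {1..N}" "k \<in> {1..K}" for X i k
    using lim[OF that(1,2), of k] weights(2)[OF that(3)] by simp
  have "\<exists>!\<pi>. ctmc_stationary G q \<pi>" by (simp add: stat)
  then show ?thesis
    by (intro conjI allI ballI impI) (simp_all only: stat S.equilibrium_marginal prob0 probk lim0 limk)
qed

end
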